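(* Let $K,P:\mathbb{N}_0\to\mathbb{N}_0$ with $K_n<P_n$ for all $n=1,2,\ldots$, let $\alpha:\mathbb{N}_0\to[0,1]$, and write $\theta_n=(K_n,P_n)$. Suppose that $$\alpha_n\,(1-q(\theta_n))=\frac{\log n+\gamma_n}{n},\qquad n=1,2,\ldots$$ for some function $\gamma:\mathbb{N}_0\to\mathbb{R}$. If $\lim_{n\to\infty}\gamma_n=\infty$, then $$\lim_{n\to\infty}P_n(\theta_n,\alpha_n)=1.$$
   Context: $\mathbb{N}_0=\{1,2,\ldots\}$ denotes the positive integers. For positive integers $K<P$ write $\theta=(K,P)$ and set $$q(\theta)=0\ \text{ if } P<2K,\qquad q(\theta)=\binom{P-K}{K}\Big/\binom{P}{K}\ \text{ if } 2K\le P.$$ Random graph model: given a number $n$ of nodes, $\theta=(K,P)$ and $\alpha\in[0,1]$, let $K_1(\theta),\ldots,K_n(\theta)$ be i.i.d. random sets, each uniformly distributed over the collection of all $K$-element subsets of $\{1,\ldots,P\}$. Let $B_{ij}(\alpha)$, $1\le i<j\le n$, be i.i.d. $\{0,1\}$-valued random variables with $\mathbb{P}[B_{ij}(\alpha)=1]=\alpha$, independent of the family $K_1(\theta),\ldots,K_n(\theta)$; put $B_{ji}(\alpha)=B_{ij}(\alpha)$. The random graph $\mathbb{K}\cap\mathbb{G}(n;\theta,\alpha)$ is the undirected graph on the vertex set $\{1,\ldots,n\}$ in which distinct nodes $i,j$ are adjacent if and only if $K_i(\theta)\cap K_j(\theta)\ne\emptyset$ and $B_{ij}(\alpha)=1$.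 (It is the intersection of a random key graph and an Erdős–Rényi graph.) $P_n(\theta,\alpha)$ denotes the probability that $\mathbb{K}\cap\mathbb{G}(n;\theta,\alpha)$ contains no isolated nodes. *)

theory Defs
  imports "HOL-Probability.Probability"
begin

definition q_theta :: "nat \<Rightarrow> nat \<Rightarrow> real" where
  "q_theta K P = (if P < 2 * K then 0 else real ((P - K) choose K) / real (P choose K))"

definition key_rings :: "nat \<Rightarrow> nat \<Rightarrow> nat set set" where
  "key_rings K P = {S. S \<subseteq> {1..P} \<and> card S = K}"

definition node_pairs :: "nat \<Rightarrow> (nat \<times> nat) set" where
  "node_pairs n = {(i, j). 1 \<le> i \<and> i < j \<and> j \<le> n}"

(* Joint law of the key rings K_1, ..., K_n and the channel variables B_ij (i < j): a product
   measure, i.e. all coordinates are mutually independent. Coordinates outside the index sets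
   carry the irrelevant default values {} and False. *)
definition model_pmf ::
  "nat \<Rightarrow> nat \<Rightarrow> nat \<Rightarrow> real \<Rightarrow> ((nat \<Rightarrow> nat set) \<times> (nat \<times> nat \<Rightarrow> bool)) pmf" where
  "model_pmf n K P \<alpha> =
     pair_pmf (Pi_pmf {1..n} {} (\<lambda>_. pmf_of_set (key_rings K P)))
              (Pi_pmf (node_pairs n) False (\<lambda>_. bernoulli_pmf \<alpha>))"

(* A graph on {1..n} is represented by its symmetric, irreflexive adjacency relation;
   (min i j, max i j) implements the convention B_ji = B_ij. *)
definition intersection_graph ::
  "nat \<Rightarrow> (nat \<Rightarrow> nat set) \<Rightarrow> (nat \<times> nat \<Rightarrow> bool) \<Rightarrow> (nat \<times> nat) set" where
  "intersection_graph n \<kappa> B =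
     {(i, j). i \<in> {1..n} \<and> j \<in> {1..n} \<and> i \<noteq> j \<and>
              \<kappa> i \<inter> \<kappa> j \<noteq> {} \<and> B (min i j, max i j)}"

definition random_intersection_graph ::
  "nat \<Rightarrow> nat \<Rightarrow> nat \<Rightarrow> real \<Rightarrow> (nat \<times> nat) set pmf" where
  "random_intersection_graph n K P \<alpha> =
     map_pmf (\<lambda>(\<kappa>, B). intersection_graph n \<kappa> B) (model_pmf n K P \<alpha>)"

definition isolated_node :: "(nat \<times> nat) set \<Rightarrow> nat \<Rightarrow> bool" where
  "isolated_node E i \<longleftrightarrow> (\<forall>j. (i, j) \<notin> E)"

definition prob_no_isolated :: "nat \<Rightarrow> nat \<Rightarrow> nat \<Rightarrow> real \<Rightarrow> real" where
  "prob_no_isolated n K P \<alpha> =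
     measure_pmf.prob (random_intersection_graph n K P \<alpha>)
       {E. \<forall>i\<in>{1..n}. \<not> isolated_node E i}"

end

theory Submission
  imports Defs
begin

text \<open>
  The proof is the first moment method. Write \<open>p = \<alpha> * (1 - q_theta K P)\<close> for the probability
  that two given nodes are adjacent. The adjacency events are not independent, because key rings
  are shared between edges. But once the key ring of one fixed node \<open>i\<close> is known, the events
  that \<open>i\<close> is adjacent to \<open>j\<close>, for \<open>j \<noteq> i\<close>, involve the separate independent variables
  \<open>K_j\<close>, \<open>B_ij\<close>; and each has conditional probability \<open>p\<close> whatever the ring of \<open>i\<close> is, since a
  uniform \<open>K\<close>-subset misses every fixed \<open>K\<close>-subset with the same probability \<open>q_theta K P\<close>.
  Hence \<open>i\<close> is isolated with probability exactly \<open>(1 - p) ^ (n - 1)\<close>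
  (lemma \<open>prob_isolated_node\<close>), and the union bound gives

  \<open>1 - prob_no_isolated n K P \<alpha> \<le> n * (1 - p) ^ (n - 1) \<le> n * exp (- p * (n - 1))\<close>.

  With \<open>p = (ln n + \<gamma>) / n\<close> the right-hand side equals \<open>exp (ln n / n - \<gamma> * (n - 1) / n)\<close>: the
  term \<open>ln n\<close> cancels the factor \<open>n\<close> up to \<open>ln n / n \<le> 1\<close>, and \<open>\<gamma> \<rightarrow> \<infinity>\<close> does the rest.
\<close>

section \<open>Disjointness of random key rings\<close>

lemma finite_key_rings: "finite (key_rings K P)"
  unfolding key_rings_def by simp

lemma card_key_rings: "card (key_rings K P) = P choose K"
  unfolding key_rings_def using n_subsets[of "{1..P}" K] by simp

lemma key_rings_nonempty: "K \<le> P \<Longrightarrow> key_rings K P \<noteq> {}"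
  using card_key_rings[of K P] by (metis binomial_eq_0_iff card.empty not_le)

lemma q_theta_eq: "q_theta K P = real ((P - K) choose K) / real (P choose K)"
  unfolding q_theta_def by (auto simp: binomial_eq_0)

lemma q_theta_nonneg: "0 \<le> q_theta K P"
  by (simp add: q_theta_eq)

lemma q_theta_le_1: "q_theta K P \<le> 1"
  by (auto simp: q_theta_eq binomial_right_mono divide_le_eq_1)

text \<open>The rings disjoint from \<open>S\<close> are the \<open>K\<close>-subsets of the \<open>P - K\<close> keys outside \<open>S\<close>.\<close>

lemma prob_disjoint_key_ring:
  assumes "K \<le> P" "S \<in> key_rings K P"
  shows "measure_pmf.prob (pmf_of_set (key_rings K P)) {T. S \<inter> T = {}} = q_theta K P"
proof -
  have S: "S \<subseteq> {1..P}" "card S = K" "finite S"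
    using assms(2) finite_subset[of S "{1..P}"] by (auto simp: key_rings_def)
  have "key_rings K P \<inter> {T. S \<inter> T = {}} = {T. T \<subseteq> {1..P} - S \<and> card T = K}"
    by (auto simp: key_rings_def)
  also have "card \<dots> = (P - K) choose K"
    using n_subsets[of "{1..P} - S" K] S by (simp add: card_Diff_subset)
  finally show ?thesis
    by (simp add: measure_pmf_of_set key_rings_nonempty assms finite_key_rings
        card_key_rings q_theta_eq)
qed

lemma nn_integral_no_edge:
  assumes "K \<le> P" "S \<in> key_rings K P" "0 \<le> \<alpha>" "\<alpha> \<le> 1"
  shows "(\<integral>\<^sup>+T. ennreal (if S \<inter> T = {} then 1 else 1 - \<alpha>) \<partial>pmf_of_set (key_rings K P))
    = ennreal (1 - \<alpha> * (1 - q_theta K P))"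
proof -
  let ?M = "pmf_of_set (key_rings K P)" and ?D = "{T. S \<inter> T = {}}"
  have "(\<integral>\<^sup>+T. ennreal (if S \<inter> T = {} then 1 else 1 - \<alpha>) \<partial>?M)
      = (\<integral>\<^sup>+T. ennreal (1 - \<alpha>) + ennreal \<alpha> * indicator ?D T \<partial>?M)"
    using assms by (intro nn_integral_cong) (auto simp flip: ennreal_plus)
  also have "\<dots> = ennreal (1 - \<alpha>) + ennreal \<alpha> * emeasure ?M ?D"
    by (simp add: nn_integral_add nn_integral_cmult)
  also have "\<dots> = ennreal (1 - \<alpha>) + ennreal \<alpha> * ennreal (q_theta K P)"
    by (simp add: measure_pmf.emeasure_eq_measure prob_disjoint_key_ring assms)
  also have "\<dots> = ennreal (1 - \<alpha> * (1 - q_theta K P))"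
    using assms q_theta_nonneg[of K P]
    by (simp add: algebra_simps flip: ennreal_mult ennreal_plus)
  finally show ?thesis .
qed

section \<open>The probability that a given node is isolated\<close>

lemma finite_node_pairs: "finite (node_pairs n)"
  by (rule finite_subset[of _ "{1..n} \<times> {1..n}"]) (auto simp: node_pairs_def)

text \<open>
  The law of the channels lives on ordered pairs; \<open>j \<mapsto> (min i j, max i j)\<close> embeds the potential
  neighbours of \<open>i\<close> into them injectively, so distinct neighbours use independent channels.
\<close>

lemma prob_channels_off:
  assumes i: "i \<in> {1..n}" and A: "A \<subseteq> {1..n} - {i}" and \<alpha>: "0 \<le> \<alpha>" "\<alpha> \<le> 1"
  shows "measure_pmf.prob (Pi_pmf (node_pairs n) False (\<lambda>_. bernoulli_pmf \<alpha>))
      {B. \<forall>j\<in>A. \<not> B (min i j, max i j)} = (1 - \<alpha>) ^ card A"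
proof -
  define pr where "pr = (\<lambda>j. (min i j, max i j))"
  define C where "C = (\<lambda>x. if x \<in> pr ` A then {False} else UNIV)"
  have inj: "inj_on pr A"
    by (auto simp: inj_on_def pr_def min_def max_def split: if_splits)
  have sub: "pr ` A \<subseteq> node_pairs n"
  proof
    fix x assume "x \<in> pr ` A"
    then obtain j where "j \<in> A" "x = pr j"
      by blast
    moreover from this A have "1 \<le> j" "j \<le> n" "j \<noteq> i"
      by auto
    ultimately show "x \<in> node_pairs n"
      using i by (simp add: pr_def node_pairs_def min_def max_def)
  qed
  have off: "measure_pmf.prob (bernoulli_pmf \<alpha>) {False} = 1 - \<alpha>"
    using \<alpha> by (simp add: measure_pmf_single)
  have "{B. \<forall>j\<in>A. \<not> B (min i j, max i j)} = Pi (node_pairs n) C"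
    using sub by (auto simp: C_def pr_def Pi_def)
  then have "measure_pmf.prob (Pi_pmf (node_pairs n) False (\<lambda>_. bernoulli_pmf \<alpha>))
      {B. \<forall>j\<in>A. \<not> B (min i j, max i j)}
    = (\<Prod>x\<in>node_pairs n. measure_pmf.prob (bernoulli_pmf \<alpha>) (C x))"
    by (simp add: measure_Pi_pmf_Pi finite_node_pairs)
  also have "\<dots> = (\<Prod>x\<in>node_pairs n. if x \<in> pr ` A then 1 - \<alpha> else 1)"
    by (intro prod.cong refl) (auto simp: C_def off)
  also have "\<dots> = (1 - \<alpha>) ^ card (pr ` A)"
    using sub finite_node_pairs
    by (simp add: prod.If_cases Int_absorb1)
  also have "\<dots> = (1 - \<alpha>) ^ card A"
    by (simp add: card_image inj)
  finally show ?thesis .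
qed

lemma isolated_intersection_graph_iff:
  assumes "i \<in> {1..n}"
  shows "isolated_node (intersection_graph n \<kappa> B) i \<longleftrightarrow>
    (\<forall>j\<in>{j\<in>{1..n} - {i}. \<kappa> i \<inter> \<kappa> j \<noteq> {}}. \<not> B (min i j, max i j))"
  using assms by (auto simp: isolated_node_def intersection_graph_def)

text \<open>
  Conditioning on the key ring \<open>S\<close> of node \<open>i\<close> is what makes the edges at \<open>i\<close> independent. The
  inner integral does not depend on \<open>S\<close>, so averaging over \<open>S\<close> leaves the value unchanged.
\<close>

lemma prob_isolated_node:
  assumes i: "i \<in> {1..n}" and KP: "K \<le> P" and \<alpha>: "0 \<le> \<alpha>" "\<alpha> \<le> 1"
  shows "measure_pmf.prob (random_intersection_graph n K P \<alpha>) {E. isolated_node E i}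
    = (1 - \<alpha> * (1 - q_theta K P)) ^ (n - 1)"
proof -
  let ?R = "pmf_of_set (key_rings K P)"
  let ?B = "Pi_pmf (node_pairs n) False (\<lambda>_. bernoulli_pmf \<alpha>)"
  let ?J = "{1..n} - {i}"
  let ?p = "\<alpha> * (1 - q_theta K P)"
  define h where "h = (\<lambda>S T :: nat set. if S \<inter> T = {} then 1 else 1 - \<alpha>)"
  have h: "0 \<le> h S T" for S T
    using \<alpha> by (simp add: h_def)
  have p: "0 \<le> 1 - ?p"
    using mult_mono[of \<alpha> 1 "1 - q_theta K P" 1] \<alpha> q_theta_nonneg[of K P] q_theta_le_1[of K P]
    by simp
  have channels: "emeasure ?B {B. isolated_node (intersection_graph n \<kappa> B) i}
      = (\<Prod>j\<in>?J. ennreal (h (\<kappa> i) (\<kappa> j)))" for \<kappa>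
  proof -
    have "measure_pmf.prob ?B {B. isolated_node (intersection_graph n \<kappa> B) i}
        = (1 - \<alpha>) ^ card {j\<in>?J. \<kappa> i \<inter> \<kappa> j \<noteq> {}}"
      unfolding isolated_intersection_graph_iff[OF i]
      by (rule prob_channels_off[OF i _ \<alpha>]) auto
    also have "\<dots> = (\<Prod>j\<in>?J. if \<kappa> i \<inter> \<kappa> j \<noteq> {} then 1 - \<alpha> else 1)"
      by (simp add: prod.If_cases Int_def)
    also have "\<dots> = (\<Prod>j\<in>?J. h (\<kappa> i) (\<kappa> j))"
      by (intro prod.cong) (auto simp: h_def)
    finally show ?thesis
      using h by (simp add: measure_pmf.emeasure_eq_measure prod_ennreal)
  qed
  have split: "Pi_pmf {1..n} {} (\<lambda>_. ?R)
      = map_pmf (\<lambda>(S, f). f(i := S)) (pair_pmf ?R (Pi_pmf ?J {} (\<lambda>_. ?R)))"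
    using Pi_pmf_insert[of ?J i "{}" "\<lambda>_. ?R"] i by (simp add: insert_absorb)
  have "emeasure (random_intersection_graph n K P \<alpha>) {E. isolated_node E i}
      = (\<integral>\<^sup>+x. indicator {E. isolated_node E i} x \<partial>random_intersection_graph n K P \<alpha>)"
    by simp
  also have "\<dots> = (\<integral>\<^sup>+\<kappa>. \<integral>\<^sup>+B. indicator {B. isolated_node (intersection_graph n \<kappa> B) i} B \<partial>?B
      \<partial>Pi_pmf {1..n} {} (\<lambda>_. ?R))"
    unfolding random_intersection_graph_def model_pmf_def nn_integral_map_pmf nn_integral_pair_pmf'
    by (intro nn_integral_cong) (simp add: indicator_def)
  also have "\<dots> = (\<integral>\<^sup>+\<kappa>. (\<Prod>j\<in>?J. ennreal (h (\<kappa> i) (\<kappa> j))) \<partial>Pi_pmf {1..n} {} (\<lambda>_. ?R))"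
    by (simp add: channels)
  also have "\<dots> = (\<integral>\<^sup>+S. \<integral>\<^sup>+f. (\<Prod>j\<in>?J. ennreal (h S (f j))) \<partial>Pi_pmf ?J {} (\<lambda>_. ?R) \<partial>?R)"
    unfolding split nn_integral_map_pmf nn_integral_pair_pmf'
    by (intro nn_integral_cong) (auto intro!: prod.cong)
  also have "\<dots> = (\<integral>\<^sup>+S. (\<Prod>j\<in>?J. \<integral>\<^sup>+T. ennreal (h S T) \<partial>?R) \<partial>?R)"
    by (intro nn_integral_cong nn_integral_prod_Pi_pmf) simp
  also have "\<dots> = (\<integral>\<^sup>+S. ennreal ((1 - ?p) ^ (n - 1)) \<partial>?R)"
  proof (intro nn_integral_cong_AE AE_pmfI)
    fix S assume "S \<in> set_pmf ?R"
    then have "S \<in> key_rings K P"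
      by (simp add: finite_key_rings key_rings_nonempty KP)
    then show "(\<Prod>j\<in>?J. \<integral>\<^sup>+T. ennreal (h S T) \<partial>?R) = ennreal ((1 - ?p) ^ (n - 1))"
      using i p by (simp add: h_def nn_integral_no_edge KP \<alpha> ennreal_power)
  qed
  also have "\<dots> = ennreal ((1 - ?p) ^ (n - 1))"
    by simp
  finally show ?thesis
    using p by (simp add: measure_pmf.emeasure_eq_measure)
qed

section \<open>The first moment bound and its limit\<close>

lemma prob_no_isolated_ge:
  assumes "K \<le> P" "0 \<le> \<alpha>" "\<alpha> \<le> 1"
  shows "1 - real n * (1 - \<alpha> * (1 - q_theta K P)) ^ (n - 1) \<le> prob_no_isolated n K P \<alpha>"
proof -
  let ?G = "random_intersection_graph n K P \<alpha>"
  let ?I = "\<lambda>i. {E. isolated_node E i}"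
  have "{E. \<forall>i\<in>{1..n}. \<not> isolated_node E i} = - (\<Union>i\<in>{1..n}. ?I i)"
    by auto
  then have "prob_no_isolated n K P \<alpha> = 1 - measure_pmf.prob ?G (\<Union>i\<in>{1..n}. ?I i)"
    unfolding prob_no_isolated_def
    using measure_pmf.prob_compl[of "\<Union>i\<in>{1..n}. ?I i" ?G] by (simp add: Compl_eq_Diff_UNIV)
  moreover have "measure_pmf.prob ?G (\<Union>i\<in>{1..n}. ?I i) \<le> (\<Sum>i\<in>{1..n}. measure_pmf.prob ?G (?I i))"
    by (intro measure_pmf.finite_measure_subadditive_finite) auto
  moreover have "\<dots> = real n * (1 - \<alpha> * (1 - q_theta K P)) ^ (n - 1)"
    using assms by (simp add: prob_isolated_node)
  ultimately show ?thesis
    by simp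
qed

text \<open>
  For \<open>n \<ge> 2\<close> the loss \<open>(n - 1) / n\<close> in the exponent costs at most a factor \<open>exp 1\<close> on the
  logarithmic part and half of \<open>\<gamma>\<close>.
\<close>

lemma first_moment_le:
  fixes g :: real
  assumes n: "2 \<le> n" and g: "0 \<le> g" and p: "p = (ln (real n) + g) / real n" "p \<le> 1"
  shows "real n * (1 - p) ^ (n - 1) \<le> exp (1 - g / 2)"
proof -
  have "(1 - p) ^ (n - 1) \<le> exp (- p) ^ (n - 1)"
    using p exp_ge_add_one_self[of "- p"] by (intro power_mono) auto
  also have "\<dots> = exp (- (p * (real n - 1)))"
    using n by (simp add: of_nat_diff mult.commute flip: exp_of_nat_mult)
  finally have "real n * (1 - p) ^ (n - 1) \<le> exp (ln (real n)) * exp (- (p * (real n - 1)))"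
    using n by (simp add: mult_left_mono)
  also have "\<dots> = exp (ln (real n) - p * (real n - 1))"
    by (simp flip: exp_add)
  also have "ln (real n) - p * (real n - 1) = ln (real n) / real n - g * (1 - 1 / real n)"
    using n by (simp add: p field_simps)
  also have "\<dots> \<le> 1 - g / 2"
  proof -
    have "ln (real n) / real n \<le> 1"
      using n ln_le_minus_one[of "real n"] by simp
    moreover have "g * (1 / 2) \<le> g * (1 - 1 / real n)"
      using n g by (intro mult_left_mono) (auto simp: field_simps)
    ultimately show ?thesis
      by simp
  qed
  finally show ?thesis
    by simp
qed

theorem mainTheorem1:
  fixes K P :: "nat \<Rightarrow> nat" and \<alpha> \<gamma> :: "nat \<Rightarrow> real"
  assumes "\<And>n. n \<ge> 1 \<Longrightarrow> 1 \<le> K n"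
    and "\<And>n. n \<ge> 1 \<Longrightarrow> K n < P n"
    and "\<And>n. n \<ge> 1 \<Longrightarrow> 0 \<le> \<alpha> n \<and> \<alpha> n \<le> 1"
    and "\<And>n. n \<ge> 1 \<Longrightarrow> \<alpha> n * (1 - q_theta (K n) (P n)) = (ln (real n) + \<gamma> n) / real n"
    and "filterlim \<gamma> at_top sequentially"
  shows "(\<lambda>n. prob_no_isolated n (K n) (P n) (\<alpha> n)) \<longlonglongrightarrow> 1"
proof (rule tendsto_sandwich)
  have "\<forall>\<^sub>F n in sequentially. 2 \<le> n \<and> 0 \<le> \<gamma> n"
    using assms(5) eventually_ge_at_top[of "2::nat"]
    by (auto simp: filterlim_at_top eventually_conj_iff)
  then show "\<forall>\<^sub>F n in sequentially.
      1 - exp (1 - \<gamma> n / 2) \<le> prob_no_isolated n (K n) (P n) (\<alpha> n)"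
  proof eventually_elim
    case (elim n)
    let ?p = "\<alpha> n * (1 - q_theta (K n) (P n))"
    have n: "n \<ge> 1"
      using elim by simp
    have "?p \<le> 1"
      using mult_mono[of "\<alpha> n" 1 "1 - q_theta (K n) (P n)" 1] assms(3)[OF n]
        q_theta_nonneg[of "K n" "P n"] q_theta_le_1[of "K n" "P n"] by simp
    then have "real n * (1 - ?p) ^ (n - 1) \<le> exp (1 - \<gamma> n / 2)"
      using elim assms(4)[OF n] by (intro first_moment_le) auto
    then show ?case
      using prob_no_isolated_ge[of "K n" "P n" "\<alpha> n" n] assms(2)[OF n] assms(3)[OF n] by simp
  qed
  show "\<forall>\<^sub>F n in sequentially. prob_no_isolated n (K n) (P n) (\<alpha> n) \<le> 1"
    by (simp add: prob_no_isolated_def)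
  have "filterlim (\<lambda>n. - 1 + (1 / 2) * \<gamma> n) at_top sequentially"
    by (intro filterlim_tendsto_add_at_top[OF tendsto_const]
        filterlim_tendsto_pos_mult_at_top[OF tendsto_const] assms(5)) simp
  then have "((\<lambda>n. exp (- (- 1 + (1 / 2) * \<gamma> n))) \<longlongrightarrow> 0) sequentially"
    by (intro filterlim_compose[OF exp_at_bot] filterlim_uminus_at_bot_at_top[THEN filterlim_compose])
  then have "(\<lambda>n. 1 - exp (1 - \<gamma> n / 2)) \<longlonglongrightarrow> 1 - 0"
    by (intro tendsto_diff tendsto_const) simp
  then show "(\<lambda>n. 1 - exp (1 - \<gamma> n / 2)) \<longlonglongrightarrow> 1"
    by simp
qed simp

end
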